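(* There exists an absolute constant $C>0$ such that for every integer $d\ge 1$ and every unconditional convex body $K\subset\mathbb{R}^d$ with $\dim(K\cap\mathbb{Z}^d)=d$, $$\#K\;\le\; C\,d\,\max_{i=1,\dots,d}\#(K\cap e_i^\perp)\;\mathrm{vol}_d(K)^{\frac1d},$$ where $e_1,\dots,e_d$ are the standard basis vectors of $\mathbb{R}^d$. Moreover, this bound is best possible up to multiplication by constants: there exists an absolute constant $c>0$ such that for every integer $d\ge1$ there is an unconditional convex body $K\subset\mathbb{R}^d$ with $\dim(K\cap\mathbb{Z}^d)=d$ and $$\#K\;\ge\; c\,d\,\max_{i=1,\dots,d}\#(K\cap e_i^\perp)\;\mathrm{vol}_d(K)^{\frac1d}.$$
   Context: A convex body in $\mathbb{R}^d$ is a convex compact subset equal to the closure of its interior. A set $K\subset\mathbb{R}^d$ is unconditional if $(\pm x_1,\pm x_2,\dots,\pm x_d)\in K$ for every $x=(x_1,\dots,x_d)\in K$ and every choice of signs. For a set $A\subset\mathbb{R}^d$, $\#A=\mathrm{card}(A\cap\mathbb{Z}^d)$ and $\dim(A)$ is the dimension of the affine hull of $A$; thus, for such $K$, $\dim(K\cap\mathbb{Z}^d)=d$ means that $K$ contains $d$ linearly independent points of $\mathbb{Z}^d$. $\mathrm{vol}_d$ is $d$-dimensional volume, and $e_i^\perp=\{x\in\mathbb{R}^d: x\cdot e_i=0\}$. *)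

theory Defs
  imports "HOL-Analysis.Analysis" "HOL-Library.Function_Algebras"
begin

text \<open>
  The dimension is quantified inside the statement, so R^d is not a type here but the
  linear subspace \<open>topspace (Euclidean_space d)\<close> of \<open>nat \<Rightarrow> real\<close>, that is, the functions
  vanishing outside \<open>{..<d}\<close>, with its Euclidean topology.  Coordinates are numbered from 0
  to d - 1.  Pointwise scalar multiplication makes the library's \<open>convex\<close>, \<open>hull\<close> and
  \<open>dim\<close> available.
\<close>

instantiation "fun" :: (type, real_vector) real_vector
begin

definition scaleR_fun :: "real \<Rightarrow> ('a \<Rightarrow> 'b) \<Rightarrow> 'a \<Rightarrow> 'b" where
  "scaleR_fun r f = (\<lambda>x. r *\<^sub>R f x)"

instance
  by standard (simp_all add: scaleR_fun_def fun_eq_iff plus_fun_def algebra_simps)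

end

abbreviation Rspace :: "nat \<Rightarrow> (nat \<Rightarrow> real) set" where
  "Rspace d \<equiv> topspace (Euclidean_space d)"

definition convex_body :: "nat \<Rightarrow> (nat \<Rightarrow> real) set \<Rightarrow> bool" where
  "convex_body d K \<longleftrightarrow>
     convex K \<and> compactin (Euclidean_space d) K \<and>
     Euclidean_space d closure_of (Euclidean_space d interior_of K) = K"

text \<open>Signs at indices outside \<open>{..<d}\<close> have no effect on points of R^d.\<close>

definition unconditional :: "(nat \<Rightarrow> real) set \<Rightarrow> bool" where
  "unconditional K \<longleftrightarrow>
     (\<forall>x\<in>K. \<forall>s. (\<forall>i. s i \<in> {-1, 1}) \<longrightarrow> (\<lambda>i. s i * x i) \<in> K)"

definition int_lattice :: "nat \<Rightarrow> (nat \<Rightarrow> real) set" where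
  "int_lattice d = {x \<in> Rspace d. \<forall>i<d. x i \<in> \<int>}"

definition lattice_card :: "nat \<Rightarrow> (nat \<Rightarrow> real) set \<Rightarrow> nat" where
  "lattice_card d A = card (A \<inter> int_lattice d)"

text \<open>
  The library's \<open>aff_dim\<close> requires a type of class \<open>euclidean_space\<close>.  Here the dimension of an
  affine hull is that of its direction space; the empty set gets dimension 0.
\<close>

definition affine_hull_dim :: "'a::real_vector set \<Rightarrow> nat" where
  "affine_hull_dim A = dim {x - y |x y. x \<in> affine hull A \<and> y \<in> affine hull A}"

text \<open>
  The product measure lives on functions that are \<open>undefined\<close> outside \<open>{..<d}\<close>, hence the
  restriction of the points of \<open>A\<close>.  On Borel sets (in particular compact ones) this is Lebesgue
  measure.
\<close>

definition vol :: "nat \<Rightarrow> (nat \<Rightarrow> real) set \<Rightarrow> real" where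
  "vol d A = measure (\<Pi>\<^sub>M i\<in>{..<d}. lborel) ((\<lambda>x. restrict x {..<d}) ` A)"

definition std_basis :: "nat \<Rightarrow> nat \<Rightarrow> real" where
  "std_basis i = (\<lambda>j. if j = i then 1 else 0)"

definition orth_compl :: "nat \<Rightarrow> (nat \<Rightarrow> real) \<Rightarrow> (nat \<Rightarrow> real) set" where
  "orth_compl d v = {x \<in> Rspace d. (\<Sum>j<d. x j * v j) = 0}"

end

theory Submission
  imports Defs "HOL-Real_Asymp.Real_Asymp"
begin

text \<open>Upper bound. Averaging a point of an unconditional convex set with its sign changes
  kills any chosen coordinates, and shrinking along an axis stays inside. Let n be the largest
  integer with n e_i in K for every i. Since the lattice points of K span the space, none of the
  coordinates vanishes on all of them (\<open>exists_nonzero_coordinate\<close>), so n >= 1. By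
  maximality (n + 1) e_i is outside K for some i, so the lattice points of K satisfy |x_i| <= n.
  Projection along e_i sends each of these 2n + 1 slices injectively into the section of K by
  e_i^perp (\<open>lattice_card_slices\<close>), whence #K <= 3 n M with M the largest section
  count. Conversely, the convex hull of the points +-n e_i contains the cube [-n/d, n/d]^d
  (\<open>cube_subset\<close>), so vol(K)^(1/d) >= 2n/d (\<open>cube_le_vol\<close>). Eliminating n
  gives C = 3/2.

  Sharpness. The unit l1-ball has volume at most (2e/d)^d (\<open>vol_cross_polytope_le\<close>), so
  d vol^(1/d) <= 2e, while a section never has more lattice points than the whole body. This gives c
  = 1/(2e).\<close>

section \<open>Coordinates, compactness and lattice points in \<open>Rspace d\<close>\<close>

lemma Rspace_iff: "x \<in> Rspace d \<longleftrightarrow> (\<forall>i\<ge>d. x i = 0)"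
  by (simp add: topspace_Euclidean_space)

text \<open>Lets compactness and closure be computed in the product topology of the ambient type
  \<open>nat => real\<close>.\<close>

lemma Euclidean_space_eq: "Euclidean_space d = top_of_set (Rspace d)"
  by (simp add: Euclidean_space_def euclidean_product_topology)

lemma sum_fun_apply: "sum f A x = (\<Sum>i\<in>A. f i x)"
  by (induction A rule: infinite_finite_induct) (auto simp: zero_fun_def)

lemma Rspace_expand:
  assumes "x \<in> Rspace d"
  shows "x = (\<Sum>i<d. x i *\<^sub>R std_basis i)"
proof
  fix j
  have "(\<Sum>i<d. x i *\<^sub>R std_basis i) j = (\<Sum>i<d. if i = j then x i else 0)"
    by (simp only: sum_fun_apply) (intro sum.cong, auto simp: scaleR_fun_def std_basis_def)
  also have "\<dots> = x j"
    using assms by (auto simp: Rspace_iff)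
  finally show "x j = (\<Sum>i<d. x i *\<^sub>R std_basis i) j" by simp
qed

lemma compactin_Euclidean_space_iff:
  "compactin (Euclidean_space d) K \<longleftrightarrow> compact K \<and> K \<subseteq> Rspace d"
  by (subst Euclidean_space_eq) (simp only: compactin_subtopology compactin_euclidean_iff)

lemma convex_body_compact:
  assumes "convex_body d K"
  shows "compact K" "K \<subseteq> Rspace d"
  using assms by (simp_all add: convex_body_def compactin_Euclidean_space_iff)

lemma compact_coordinate_bound:
  fixes K :: "(nat \<Rightarrow> real) set"
  assumes "compact K"
  obtains B where "B \<ge> 0" "\<And>x i. x \<in> K \<Longrightarrow> i < d \<Longrightarrow> \<bar>x i\<bar> \<le> B"
proof -
  have c: "continuous_on K (\<lambda>x. x i)" for i :: nat
    by (rule continuous_on_subset[OF continuous_on_product_coordinates]) simp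
  have "compact ((\<lambda>x. \<Sum>i<d. \<bar>x i\<bar>) ` K)"
    by (rule compact_continuous_image[OF _ assms]) (intro continuous_intros c)
  then obtain B where "\<And>y. y \<in> (\<lambda>x. \<Sum>i<d. \<bar>x i\<bar>) ` K \<Longrightarrow> norm y \<le> B"
    by (meson compact_imp_bounded bounded_iff)
  then have B: "\<And>x. x \<in> K \<Longrightarrow> (\<Sum>i<d. \<bar>x i\<bar>) \<le> B"
    by force
  show ?thesis
  proof
    fix x i assume "x \<in> K" "i < d"
    have "\<bar>x i\<bar> \<le> (\<Sum>i<d. \<bar>x i\<bar>)"
      by (rule member_le_sum) (use \<open>i < d\<close> in auto)
    then show "\<bar>x i\<bar> \<le> max 0 B" using B[OF \<open>x \<in> K\<close>] by simp
  qed simp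
qed

text \<open>A lattice point is determined by its first d coordinates, which are integers in a
  bounded interval. Since \<open>card\<close> is 0 on infinite sets, comparing lattice counts
  depends on this finiteness.\<close>

lemma finite_lattice_points:
  assumes "compact K"
  shows "finite (K \<inter> int_lattice d)"
proof -
  obtain B where B: "\<And>x i. x \<in> K \<Longrightarrow> i < d \<Longrightarrow> \<bar>x i\<bar> \<le> B"
    using compact_coordinate_bound[OF assms] by metis
  let ?F = "{k::real. k \<in> \<int> \<and> \<bar>k\<bar> \<le> B}"
  have "finite (Pi\<^sub>E {..<d} (\<lambda>_. ?F))"
    by (intro finite_PiE finite_lessThan finite_abs_int_segment)
  moreover have "(\<lambda>x. restrict x {..<d}) ` (K \<inter> int_lattice d) \<subseteq> Pi\<^sub>E {..<d} (\<lambda>_. ?F)"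
    using B by (intro image_subsetI) (simp add: int_lattice_def restrict_PiE_iff)
  moreover have "inj_on (\<lambda>x. restrict x {..<d}) (K \<inter> int_lattice d)"
  proof (rule inj_onI, rule ext)
    fix x y i assume a: "x \<in> K \<inter> int_lattice d" "y \<in> K \<inter> int_lattice d"
      "restrict x {..<d} = restrict y {..<d}"
    show "x i = y i"
    proof (cases "i < d")
      case True then show ?thesis using fun_cong[OF a(3), of i] by simp
    next
      case False then show ?thesis using a by (simp add: int_lattice_def Rspace_iff)
    qed
  qed
  ultimately show ?thesis
    by (meson finite_imageD finite_subset)
qed

section \<open>Volume of compact sets and of cubes\<close>

text \<open>Extension by zero \<open>g\<close> is measurable and inverts the restriction on
  \<open>Rspace d\<close>, so the restricted set is the preimage under \<open>g\<close> of the Borel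
  set \<open>K\<close>.\<close>

lemma restrict_image_in_sets_PiM:
  assumes "compact K" "K \<subseteq> Rspace d"
  shows "(\<lambda>x. restrict x {..<d}) ` K \<in> sets (\<Pi>\<^sub>M i\<in>{..<d}. lborel :: real measure)"
proof -
  define g where "g = (\<lambda>(y::nat \<Rightarrow> real) i. if i < d then y i else 0)"
  let ?M = "\<Pi>\<^sub>M i\<in>{..<d}. lborel :: real measure"
  have "g \<in> measurable ?M (\<Pi>\<^sub>M i\<in>UNIV. borel)"
  proof (rule measurable_PiM_single')
    fix i :: nat
    show "(\<lambda>y. g y i) \<in> borel_measurable ?M"
      unfolding g_def by (cases "i < d") (auto intro: measurable_component_singleton[of _ _ "\<lambda>_. lborel", simplified])
  qed (auto simp: g_def)
  moreover have "K \<in> sets (\<Pi>\<^sub>M i\<in>UNIV. borel)"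
    using assms(1) by (simp add: sets_PiM_equal_borel borel_compact)
  ultimately have "g -` K \<inter> space ?M \<in> sets ?M"
    by (rule measurable_sets)
  also have "g -` K \<inter> space ?M = (\<lambda>x. restrict x {..<d}) ` K"
  proof (intro equalityI subsetI)
    fix y assume y: "y \<in> g -` K \<inter> space ?M"
    then have "y = restrict (g y) {..<d}"
      by (fastforce simp: g_def space_PiM PiE_def extensional_def)
    then show "y \<in> (\<lambda>x. restrict x {..<d}) ` K" using y by blast
  next
    fix y assume "y \<in> (\<lambda>x. restrict x {..<d}) ` K"
    then obtain x where x: "x \<in> K" "y = restrict x {..<d}" by blast
    moreover have "g (restrict x {..<d}) = x"
      using assms(2) x(1) by (fastforce simp: g_def Rspace_iff)
    ultimately show "y \<in> g -` K \<inter> space ?M"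
      by (auto simp: space_PiM)
  qed
  finally show ?thesis .
qed

lemma emeasure_cube:
  assumes "r \<ge> 0"
  shows "emeasure (\<Pi>\<^sub>M i\<in>{..<d}. lborel) (Pi\<^sub>E {..<d} (\<lambda>_. {-r..r})) = ennreal ((2 * r) ^ d)"
proof -
  interpret product_sigma_finite "\<lambda>_::nat. lborel :: real measure" ..
  show ?thesis
    using assms by (subst emeasure_PiM) (auto simp: ennreal_power)
qed

lemma cube_le_vol:
  assumes "compact K" "K \<subseteq> Rspace d" "r \<ge> 0"
    and cube: "\<And>x. x \<in> Rspace d \<Longrightarrow> (\<And>i. i < d \<Longrightarrow> \<bar>x i\<bar> \<le> r) \<Longrightarrow> x \<in> K"
  shows "(2 * r) ^ d \<le> vol d K"
proof -
  let ?M = "\<Pi>\<^sub>M i\<in>{..<d}. lborel :: real measure"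
  let ?R = "(\<lambda>x. restrict x {..<d}) ` K"
  let ?Q = "\<lambda>r. Pi\<^sub>E {..<d} (\<lambda>_. {-r..r})"
  obtain B where B: "B \<ge> 0" "\<And>x i. x \<in> K \<Longrightarrow> i < d \<Longrightarrow> \<bar>x i\<bar> \<le> B"
    using compact_coordinate_bound[OF assms(1)] by metis
  have Qs: "?Q s \<in> sets ?M" for s
    by (rule sets_PiM_I_finite) auto
  have R: "?R \<in> sets ?M"
    using restrict_image_in_sets_PiM assms by blast
  \<comment> \<open>An enclosing cube gives finite measure; \<open>measure\<close> sends infinite
    measure to 0, so monotonicity would otherwise fail.\<close>
  have "?R \<subseteq> ?Q B"
  proof (rule image_subsetI)
    fix x assume "x \<in> K"
    then have "x i \<in> {-B..B}" if "i < d" for i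
      using B(2)[of x i] that by (simp add: abs_le_iff)
    then show "restrict x {..<d} \<in> ?Q B" by (simp add: restrict_PiE_iff)
  qed
  then have "emeasure ?M ?R \<le> emeasure ?M (?Q B)"
    using Qs by (rule emeasure_mono)
  then have fin: "?R \<in> fmeasurable ?M"
    using R B(1) by (auto simp: fmeasurable_def emeasure_cube intro: le_less_trans)
  have "?Q r \<subseteq> ?R"
  proof
    fix y assume y: "y \<in> ?Q r"
    define x where "x i = (if i < d then y i else 0)" for i
    have "x \<in> K"
      by (rule cube) (use y in \<open>auto simp: x_def Rspace_iff abs_le_iff PiE_iff minus_le_iff\<close>)
    moreover have "y = restrict x {..<d}"
      using y by (fastforce simp: x_def PiE_def extensional_def)
    ultimately show "y \<in> ?R" by blast
  qed
  then have "measure ?M (?Q r) \<le> measure ?M ?R"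
    using Qs fin by (rule measure_mono_fmeasurable)
  moreover have "measure ?M (?Q r) = (2 * r) ^ d"
    using assms(3) by (simp add: measure_def emeasure_cube)
  ultimately show ?thesis by (simp add: vol_def)
qed

section \<open>Axis points and cubes in unconditional convex sets\<close>

lemma unconditionalD:
  assumes "unconditional K" "x \<in> K" "\<And>i. s i \<in> {-1, 1}"
  shows "(\<lambda>i. s i * x i) \<in> K"
  using assms by (simp add: unconditional_def)

text \<open>The result is the midpoint of \<open>x\<close> and the point obtained by flipping the
  signs of the coordinates outside \<open>I\<close>.\<close>

lemma unconditional_zero_out:
  assumes "convex K" "unconditional K" "x \<in> K"
  shows "(\<lambda>i. if i \<in> I then x i else 0) \<in> K"
proof -
  let ?s = "\<lambda>i. if i \<in> I then 1 else -1 :: real"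
  have "(\<lambda>i. ?s i * x i) \<in> K"
    by (rule unconditionalD[OF assms(2,3)]) simp
  then have "(1/2) *\<^sub>R x + (1/2) *\<^sub>R (\<lambda>i. ?s i * x i) \<in> K"
    using assms(1,3) by (intro convexD) auto
  also have "(1/2) *\<^sub>R x + (1/2) *\<^sub>R (\<lambda>i. ?s i * x i) = (\<lambda>i. if i \<in> I then x i else 0)"
    by (auto simp: scaleR_fun_def fun_eq_iff)
  finally show ?thesis .
qed

lemma unconditional_axis_point:
  assumes "convex K" "unconditional K" "x \<in> K" "\<bar>t\<bar> \<le> \<bar>x i\<bar>"
  shows "t *\<^sub>R std_basis i \<in> K"
proof -
  define v where "v = (\<lambda>j. if j \<in> {i} then x j else 0)"
  have v: "v \<in> K"
    unfolding v_def by (rule unconditional_zero_out[OF assms(1-3)])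
  show ?thesis
  proof (cases "x i = 0")
    case True
    then have "t *\<^sub>R std_basis i = v"
      using assms(4) by (auto simp: v_def scaleR_fun_def std_basis_def fun_eq_iff)
    then show ?thesis using v by simp
  next
    case False
    have "(\<lambda>j. (\<lambda>_. -1) j * v j) \<in> K"
      using unconditionalD[OF assms(2) v, of "\<lambda>_. -1"] by simp
    then have w: "(\<lambda>j. - v j) \<in> K" by simp
    \<comment> \<open>Chosen so that u v + (1 - u)(-v) = (2u - 1) v = (t / x_i) v, which is t
      e_i.\<close>
    define u where "u = (1 + t / x i) / 2"
    have q: "\<bar>t / x i\<bar> \<le> 1"
      using assms(4) False by (simp add: abs_divide)
    have "0 \<le> u" "u \<le> 1"
      using abs_le_D1[OF q] abs_le_D2[OF q] by (simp_all add: u_def)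
    then have "u *\<^sub>R v + (1 - u) *\<^sub>R (\<lambda>j. - v j) \<in> K"
      using assms(1) v w by (intro convexD) auto
    also have "u *\<^sub>R v + (1 - u) *\<^sub>R (\<lambda>j. - v j) = t *\<^sub>R std_basis i"
      using False by (auto simp: fun_eq_iff scaleR_fun_def std_basis_def v_def u_def field_simps)
    finally show ?thesis .
  qed
qed

text \<open>\<open>x\<close> is the average of the d axis points (d x_i) e_i, and each of them is in
  \<open>K\<close> because |d x_i| <= a.\<close>

lemma cube_subset:
  assumes "convex K" "unconditional K" "d \<ge> 1"
    and ax: "\<And>i. i < d \<Longrightarrow> a *\<^sub>R std_basis i \<in> K"
    and x: "x \<in> Rspace d" "\<And>i. i < d \<Longrightarrow> \<bar>x i\<bar> \<le> a / d"
  shows "x \<in> K"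
proof -
  have "(\<Sum>i<d. (1 / d) *\<^sub>R ((d * x i) *\<^sub>R std_basis i)) \<in> K"
  proof (rule convex_sum)
    fix i assume "i \<in> {..<d}"
    then have i: "i < d" by simp
    have "\<bar>d * x i\<bar> \<le> a"
      using x(2)[OF i] assms(3) by (simp add: abs_mult field_simps)
    then show "(d * x i) *\<^sub>R std_basis i \<in> K"
      by (intro unconditional_axis_point[OF assms(1,2) ax[OF i]])
        (simp add: scaleR_fun_def std_basis_def)
  qed (use assms(1,3) in auto)
  also have "(\<Sum>i<d. (1 / d) *\<^sub>R ((d * x i) *\<^sub>R std_basis i)) = x"
    using Rspace_expand[OF x(1)] assms(3) by simp
  finally show ?thesis .
qed

section \<open>Lattice points in slices, and the upper bound\<close>

lemma orth_compl_std_basis: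
  assumes "i < d"
  shows "orth_compl d (std_basis i) = {x \<in> Rspace d. x i = 0}"
proof -
  have "(\<Sum>j<d. x j * std_basis i j) = x i" for x
  proof -
    have "(\<Sum>j<d. x j * std_basis i j) = (\<Sum>j<d. if j = i then x j else 0)"
      by (intro sum.cong) (auto simp: std_basis_def)
    then show ?thesis using assms by simp
  qed
  then show ?thesis by (simp add: orth_compl_def)
qed

text \<open>A point is recovered from its i-th coordinate and its projection along e_i. The
  coordinate takes at most 2n + 1 integer values, and the projection stays in \<open>K\<close> by
  unconditionality.\<close>

lemma lattice_card_slices:
  fixes n :: nat
  assumes "convex K" "unconditional K" "compact K" "K \<subseteq> Rspace d" "i < d"
    and bnd: "\<And>x. x \<in> K \<inter> int_lattice d \<Longrightarrow> \<bar>x i\<bar> \<le> n"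
  shows "lattice_card d K \<le> (2 * n + 1) * lattice_card d (K \<inter> orth_compl d (std_basis i))"
proof -
  let ?H = "K \<inter> orth_compl d (std_basis i) \<inter> int_lattice d"
  let ?p = "\<lambda>x j. if j \<in> - {i} then x j else (0::real)"
  let ?f = "\<lambda>x. (x i, ?p x)"
  let ?T = "(real_of_int ` {-int n..int n}) \<times> ?H"
  have finH: "finite ?H"
    by (rule finite_subset[OF _ finite_lattice_points[OF assms(3), of d]]) auto
  have "inj_on ?f (K \<inter> int_lattice d)"
  proof (rule inj_onI, rule ext)
    fix x y j assume eq: "?f x = ?f y"
    then have i: "x i = y i" by (rule Pair_inject)
    have p: "?p x = ?p y" using eq by (rule Pair_inject)
    show "x j = y j"
    proof (cases "j = i")
      case False
      then show ?thesis using fun_cong[OF p, of j] by simp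
    qed (use i in simp)
  qed
  moreover have "?f ` (K \<inter> int_lattice d) \<subseteq> ?T"
  proof (rule image_subsetI)
    fix x assume x: "x \<in> K \<inter> int_lattice d"
    then have "x i \<in> \<int>" using assms(5) by (simp add: int_lattice_def)
    then obtain k where k: "x i = of_int k" by (rule Ints_cases)
    have "k \<in> {-int n..int n}"
      using bnd[OF x] unfolding k by auto
    then have "x i \<in> real_of_int ` {-int n..int n}" using k by auto
    moreover have "?p x \<in> K"
      using x by (intro unconditional_zero_out[OF assms(1,2)]) auto
    moreover have "?p x \<in> orth_compl d (std_basis i) \<inter> int_lattice d"
      using x assms(5) by (auto simp: orth_compl_std_basis int_lattice_def Rspace_iff)
    ultimately show "?f x \<in> ?T" by simp
  qed
  ultimately have "card (K \<inter> int_lattice d) \<le> card ?T"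
    using finH by (intro card_inj_on_le) auto
  also have "card ?T = (2 * n + 1) * card ?H"
    by (simp add: card_cartesian_product card_image inj_on_def nat_add_distrib nat_mult_distrib)
  finally show ?thesis
    by (simp add: lattice_card_def Int_assoc)
qed

text \<open>Otherwise \<open>S\<close>, and hence its affine hull and all differences, would lie in
  the span of the other d - 1 basis vectors.\<close>

lemma exists_nonzero_coordinate:
  assumes dim: "affine_hull_dim S = d" and "S \<subseteq> Rspace d" "i < d"
  shows "\<exists>x\<in>S. x i \<noteq> 0"
proof (rule ccontr)
  assume "\<not> ?thesis"
  then have z: "\<And>x. x \<in> S \<Longrightarrow> x i = 0" by blast
  let ?W = "std_basis ` ({..<d} - {i})"
  have "S \<subseteq> span ?W"
  proof
    fix x assume x: "x \<in> S"
    have "x = (\<Sum>j<d. x j *\<^sub>R std_basis j)"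
      using x assms(2) by (intro Rspace_expand) auto
    also have "\<dots> = (\<Sum>j\<in>{..<d} - {i}. x j *\<^sub>R std_basis j)"
      using z[OF x] assms(3) by (subst sum.remove[of _ i]) auto
    also have "\<dots> \<in> span ?W"
      by (intro span_sum span_scale span_base imageI)
    finally show "x \<in> span ?W" .
  qed
  then have "affine hull S \<subseteq> span ?W"
    using affine_hull_subset_span span_minimal[OF _ subspace_span] by blast
  then have "{x - y |x y. x \<in> affine hull S \<and> y \<in> affine hull S} \<subseteq> span ?W"
    by (auto intro: span_diff)
  then have "affine_hull_dim S \<le> card ?W"
    unfolding affine_hull_dim_def by (intro real_vector.dim_le_card) auto
  also have "\<dots> \<le> card ({..<d} - {i})" by (intro card_image_le) simp
  also have "\<dots> < d" using assms(3) by simp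
  finally show False using dim by simp
qed

text \<open>With \<open>n\<close> the largest integer such that all \<open>n e\<^sub>i\<close> lie in \<open>K\<close>, slicing orthogonally to a
  direction in which \<open>n\<close> cannot be increased bounds the lattice points by \<open>2n + 1 \<le> 3n\<close> sections,
  while \<open>K\<close> contains the cube with sides \<open>2n / d\<close>, whence \<open>2n / d \<le> vol K powr (1 / d)\<close>.\<close>

lemma unconditional_slicing_upper:
  assumes "d \<ge> 1" "convex_body d K" "unconditional K" "affine_hull_dim (K \<inter> int_lattice d) = d"
  shows "real (lattice_card d K)
     \<le> 3 / 2 * real d * real (MAX i\<in>{..<d}. lattice_card d (K \<inter> orth_compl d (std_basis i)))
        * vol d K powr (1 / real d)"
proof -
  let ?s = "\<lambda>i. lattice_card d (K \<inter> orth_compl d (std_basis i))"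
  let ?M = "MAX i\<in>{..<d}. ?s i"
  have cvx: "convex K" using assms(2) by (simp add: convex_body_def)
  note cpt = convex_body_compact[OF assms(2)]
  define P where "P n i \<longleftrightarrow> real n *\<^sub>R std_basis i \<in> K" for n i
  have axis: "P n i" if "x \<in> K" "real n \<le> \<bar>x i\<bar>" for x n i
    unfolding P_def using unconditional_axis_point[OF cvx assms(3) that(1)] that(2) by simp
  have int_ge: "\<bar>x i\<bar> \<ge> real (Suc n)" if "x \<in> int_lattice d" "i < d" "\<bar>x i\<bar> > real n" for x i n
  proof -
    have "x i \<in> \<int>" using that by (simp add: int_lattice_def)
    then obtain k where k: "x i = of_int k" by (rule Ints_cases)
    then have "int n < \<bar>k\<bar>" using that(3) by linarith
    then have "int (Suc n) \<le> \<bar>k\<bar>" by simp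
    then show ?thesis unfolding k by linarith
  qed
  have P1: "P 1 i" if i: "i < d" for i
  proof -
    obtain x where "x \<in> K \<inter> int_lattice d" "x i \<noteq> 0"
      using exists_nonzero_coordinate[OF assms(4) _ i] by (auto simp: int_lattice_def)
    then show ?thesis using axis[of x 1 i] int_ge[of x i 0] i by auto
  qed
  obtain B where B: "\<And>x i. x \<in> K \<Longrightarrow> i < d \<Longrightarrow> \<bar>x i\<bar> \<le> B"
    using compact_coordinate_bound[OF cpt(1)] by metis
  \<comment> \<open>\<open>Q n\<close> says that n cannot be raised to n + 1 in all directions at
    once; its least solution is the sought maximal n.\<close>
  define Q where "Q n \<longleftrightarrow> (\<exists>i<d. \<not> P (Suc n) i)" for n
  define n where "n = (LEAST n. Q n)"
  have "Q (nat \<lceil>B\<rceil>)"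
  proof -
    have "\<not> P (Suc (nat \<lceil>B\<rceil>)) 0"
    proof
      assume "P (Suc (nat \<lceil>B\<rceil>)) 0"
      then have "\<bar>real (Suc (nat \<lceil>B\<rceil>))\<bar> \<le> B"
        using B[of _ 0] assms(1) unfolding P_def by (force simp: scaleR_fun_def std_basis_def)
      then show False by linarith
    qed
    then show ?thesis unfolding Q_def using assms(1) by (intro exI[of _ 0]) auto
  qed
  then have "Q n" unfolding n_def by (rule LeastI)
  then obtain i where i: "i < d" "\<not> P (Suc n) i" unfolding Q_def by blast
  \<comment> \<open>\<open>Q 0\<close> would contradict \<open>P1\<close>. So n has a predecessor,
    where \<open>Q\<close> fails by minimality, and this failure is exactly \<open>P n i\<close> for
    all i.\<close>
  have n0: "n \<noteq> 0" using i P1 by (metis One_nat_def)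
  then have "\<not> Q (n - 1)" unfolding n_def by (intro not_less_Least) simp
  then have Pn: "\<And>i. i < d \<Longrightarrow> P n i" using n0 by (auto simp: Q_def)
  \<comment> \<open>A lattice point with |x_i| > n has |x_i| >= n + 1 by integrality, which would
    put (n + 1) e_i into \<open>K\<close>.\<close>
  have "lattice_card d K \<le> (2 * n + 1) * ?s i"
    by (rule lattice_card_slices[OF cvx assms(3) cpt i(1)])
      (use axis int_ge i in \<open>force simp: not_less[symmetric]\<close>)
  also have "\<dots> \<le> (3 * n) * ?M"
    using i(1) n0 by (intro mult_mono Max_ge) auto
  finally have "real (lattice_card d K) \<le> real (3 * n * ?M)"
    by (rule of_nat_mono)
  then have card: "real (lattice_card d K) \<le> 3 * real n * real ?M"
    by simp
  have "(2 * (real n / d)) ^ d \<le> vol d K"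
    by (rule cube_le_vol[OF cpt], simp, rule cube_subset[OF cvx assms(3,1)])
      (use Pn in \<open>auto simp: P_def\<close>)
  then have "((2 * (real n / d)) ^ d) powr (1 / d) \<le> vol d K powr (1 / d)"
    by (intro powr_mono2) auto
  moreover have "((2 * (real n / d)) ^ d) powr (1 / d) = 2 * (real n / d)"
    using n0 assms(1) by (simp add: powr_realpow[symmetric] powr_powr)
  ultimately have "2 * (real n / d) \<le> vol d K powr (1 / d)" by (simp only:)
  then have "real n \<le> d / 2 * vol d K powr (1 / d)"
    using assms(1) by (simp add: field_simps)
  then have "3 * real n * real ?M \<le> 3 * (d / 2 * vol d K powr (1 / d)) * real ?M"
    by (intro mult_mono) auto
  then show ?thesis using card by (simp add: mult_ac)
qed

section \<open>The cross-polytope as an admissible body\<close>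

definition cross_polytope :: "nat \<Rightarrow> (nat \<Rightarrow> real) set" where
  "cross_polytope d = {x \<in> Rspace d. (\<Sum>i<d. \<bar>x i\<bar>) \<le> 1}"

lemma continuous_on_l1: "continuous_on UNIV (\<lambda>x::nat \<Rightarrow> real. \<Sum>i<d. \<bar>x i\<bar>)"
  by (intro continuous_intros continuous_on_product_coordinates)

text \<open>It is a closed subset of the infinite product of copies of [-1, 1], which is compact by
  Tychonoff.\<close>

lemma compact_cross_polytope: "compact (cross_polytope d)"
proof -
  let ?Q = "Pi\<^sub>E UNIV (\<lambda>_::nat. {-1..1::real})"
  have "compactin (powertop_real UNIV) ?Q"
    by (simp add: compactin_PiE)
  then have "compact ?Q"
    by (simp add: euclidean_product_topology)
  moreover have "closed (cross_polytope d)"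
  proof -
    have "closed (Rspace d)"
      by (rule closedin_Euclidean_imp_closed[OF closedin_topspace])
    moreover have "closed {x::nat \<Rightarrow> real. (\<Sum>i<d. \<bar>x i\<bar>) \<le> 1}"
      by (intro closed_Collect_le continuous_on_l1 continuous_on_const)
    ultimately show ?thesis
      by (auto simp: cross_polytope_def Collect_conj_eq)
  qed
  moreover have "cross_polytope d \<subseteq> ?Q"
  proof
    fix x assume x: "x \<in> cross_polytope d"
    have "\<bar>x i\<bar> \<le> 1" for i
    proof (cases "i < d")
      case True
      then have "\<bar>x i\<bar> \<le> (\<Sum>i<d. \<bar>x i\<bar>)" by (intro member_le_sum) auto
      then show ?thesis using x by (simp add: cross_polytope_def)
    qed (use x in \<open>simp add: cross_polytope_def Rspace_iff\<close>)
    then show "x \<in> ?Q" by (simp add: PiE_iff abs_le_iff minus_le_iff)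
  qed
  ultimately show ?thesis
    using compact_Int_closed by (metis inf.absorb_iff2)
qed

lemma convex_cross_polytope: "convex (cross_polytope d)"
proof (rule convexI)
  fix x y u v assume xy: "x \<in> cross_polytope d" "y \<in> cross_polytope d"
    and uv: "0 \<le> u" "0 \<le> v" "u + v = (1::real)"
  have "(\<Sum>i<d. \<bar>u * x i + v * y i\<bar>) \<le> (\<Sum>i<d. u * \<bar>x i\<bar> + v * \<bar>y i\<bar>)"
    by (intro sum_mono order_trans[OF abs_triangle_ineq]) (use uv in \<open>simp add: abs_mult\<close>)
  also have "\<dots> = u * (\<Sum>i<d. \<bar>x i\<bar>) + v * (\<Sum>i<d. \<bar>y i\<bar>)"
    by (simp add: sum.distrib sum_distrib_left)
  also have "\<dots> \<le> 1"
    using xy uv by (intro convex_bound_le) (auto simp: cross_polytope_def)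
  finally show "u *\<^sub>R x + v *\<^sub>R y \<in> cross_polytope d"
    using xy by (simp add: cross_polytope_def scaleR_fun_def Rspace_iff)
qed

text \<open>For the closure condition, t x with 0 <= t < 1 has l1-norm below 1 and so is interior.
  By continuity in t, the limit x at t = 1 lies in the closure of the interior.\<close>

lemma convex_body_cross_polytope: "convex_body d (cross_polytope d)"
proof -
  let ?X = "Euclidean_space d" and ?P = "cross_polytope d"
  let ?U = "{x::nat \<Rightarrow> real. (\<Sum>i<d. \<bar>x i\<bar>) < 1}"
  have sub: "?P \<subseteq> Rspace d" by (auto simp: cross_polytope_def)
  have clP: "closedin ?X ?P"
    using compact_cross_polytope sub
    by (simp add: closedin_Euclidean_space_iff compact_imp_closed)
  have "open ?U"
    by (intro open_Collect_less continuous_on_l1 continuous_on_const)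
  then have "openin ?X (Rspace d \<inter> ?U)"
    by (subst Euclidean_space_eq) (rule openin_open_Int)
  then have inner: "Rspace d \<inter> ?U \<subseteq> ?X interior_of ?P"
    by (intro interior_of_maximal) (auto simp: cross_polytope_def)
  have "?X closure_of (?X interior_of ?P) = ?P"
  proof
    show "?X closure_of (?X interior_of ?P) \<subseteq> ?P"
      by (rule closure_of_minimal[OF interior_of_subset clP])
  next
    let ?I = "?X interior_of ?P"
    have Isub: "?I \<subseteq> Rspace d" by (rule interior_of_subset_topspace)
    show "?P \<subseteq> ?X closure_of ?I"
    proof
      fix x assume x: "x \<in> ?P"
      let ?f = "\<lambda>(t::real) i. t * x i"
      have "?f ` {0..<1} \<subseteq> ?I"
      proof (rule image_subsetI, rule subsetD[OF inner])
        fix t :: real assume t: "t \<in> {0..<1}"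
        have "(\<Sum>i<d. \<bar>t * x i\<bar>) = t * (\<Sum>i<d. \<bar>x i\<bar>)"
          using t by (simp add: abs_mult sum_distrib_left)
        also have "\<dots> \<le> t * 1"
          using x t by (intro mult_left_mono) (auto simp: cross_polytope_def)
        finally show "?f t \<in> Rspace d \<inter> ?U"
          using x t by (simp add: cross_polytope_def Rspace_iff)
      qed
      then have "?f ` {0..<1} \<subseteq> closure ?I"
        using closure_subset by blast
      then have "?f ` closure {0..<1} \<subseteq> closure ?I"
        by (intro image_closure_subset closed_closure continuous_intros)
      moreover have "(1::real) \<in> closure {0..<1}" by simp
      ultimately have "?f 1 \<in> closure ?I" by blast
      then have "x \<in> closure ?I" by simp
      then show "x \<in> ?X closure_of ?I"
        using Isub x sub
        by (subst Euclidean_space_eq) (auto simp: closure_of_subtopology Int_absorb1)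
    qed
  qed
  then show ?thesis
    using convex_cross_polytope compact_cross_polytope sub
    by (simp add: convex_body_def compactin_Euclidean_space_iff)
qed

lemma unconditional_cross_polytope: "unconditional (cross_polytope d)"
  unfolding unconditional_def
proof (intro ballI allI impI)
  fix x and s :: "nat \<Rightarrow> real" assume x: "x \<in> cross_polytope d" and s: "\<forall>i. s i \<in> {-1, 1::real}"
  have "\<bar>s i * x i\<bar> = \<bar>x i\<bar>" for i
    using spec[OF s, of i] by (auto simp: abs_mult)
  then show "(\<lambda>i. s i * x i) \<in> cross_polytope d"
    using x by (simp add: cross_polytope_def Rspace_iff)
qed

lemma inj_on_std_basis: "inj_on std_basis A"
proof (rule inj_onI)
  fix i j assume "std_basis i = std_basis j"
  then show "i = j" by (auto dest: fun_cong[of _ _ i] simp: std_basis_def split: if_splits)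
qed

lemma independent_std_basis: "independent (std_basis ` {..<d})"
proof (rule real_vector.independent_if_scalars_zero)
  fix f :: "(nat \<Rightarrow> real) \<Rightarrow> real" and v assume 0: "(\<Sum>v\<in>std_basis ` {..<d}. f v *\<^sub>R v) = 0" and "v \<in> std_basis ` {..<d}"
  then obtain i where i: "i < d" "v = std_basis i" by auto
  have "0 = (\<Sum>v\<in>std_basis ` {..<d}. f v *\<^sub>R v) i"
    using 0 by (simp add: zero_fun_def)
  also have "\<dots> = (\<Sum>j<d. f (std_basis j) * std_basis j i)"
    by (simp add: sum.reindex inj_on_std_basis sum_fun_apply scaleR_fun_def)
  also have "\<dots> = (\<Sum>j<d. if j = i then f (std_basis j) else 0)"
    by (intro sum.cong) (auto simp: std_basis_def)
  also have "\<dots> = f v" using i by simp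
  finally show "f v = 0" by simp
qed simp

text \<open>The origin and all e_i are lattice points of the body, so the direction space contains
  the standard basis; it also lies in its span.\<close>

lemma affine_hull_dim_cross_polytope:
  "affine_hull_dim (cross_polytope d \<inter> int_lattice d) = d"
proof -
  let ?S = "cross_polytope d \<inter> int_lattice d" and ?B = "std_basis ` {..<d}"
  let ?V = "{x - y |x y. x \<in> affine hull ?S \<and> y \<in> affine hull ?S}"
  have "std_basis i \<in> ?S" if "i < d" for i
    using that by (auto simp: cross_polytope_def int_lattice_def Rspace_iff std_basis_def if_distrib cong: if_cong)
  then have e: "std_basis i \<in> affine hull ?S" if "i < d" for i
    using that by (intro hull_inc)
  have z: "0 \<in> affine hull ?S"
    by (intro hull_inc) (auto simp: cross_polytope_def int_lattice_def Rspace_iff)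
  have "?S \<subseteq> span ?B"
  proof
    fix x assume "x \<in> ?S"
    then have "x = (\<Sum>i<d. x i *\<^sub>R std_basis i)"
      by (intro Rspace_expand) (auto simp: cross_polytope_def)
    also have "\<dots> \<in> span ?B"
      by (intro span_sum span_scale span_base imageI)
    finally show "x \<in> span ?B" .
  qed
  then have "affine hull ?S \<subseteq> span ?B"
    using affine_hull_subset_span span_minimal[OF _ subspace_span] by blast
  then have "?V \<subseteq> span ?B" by (auto intro: span_diff)
  moreover have "?B \<subseteq> ?V"
  proof (rule image_subsetI)
    fix i assume "i \<in> {..<d}"
    then have "std_basis i = std_basis i - 0 \<and> std_basis i \<in> affine hull ?S \<and> 0 \<in> affine hull ?S"
      using e z by simp
    then show "std_basis i \<in> ?V" by blast
  qed
  ultimately show ?thesis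
    unfolding affine_hull_dim_def
    by (intro real_vector.dim_unique[of ?B] independent_std_basis)
      (simp_all add: card_image inj_on_std_basis)
qed

section \<open>Volume of the cross-polytope and sharpness\<close>

lemma nn_integral_exp_abs:
  assumes "a > 0"
  shows "(\<integral>\<^sup>+t. ennreal (exp (- a * \<bar>t\<bar>)) \<partial>lborel) \<le> ennreal (2 / a)"
proof -
  let ?h = "\<lambda>t::real. ennreal (exp (- a * t)) * indicator {0..} t"
  have h: "(\<integral>\<^sup>+t. ?h t \<partial>lborel) = ennreal (1 / a)"
  proof -
    have "(\<integral>\<^sup>+t. ?h t \<partial>lborel) = ennreal (0 - (- exp (- a * 0) / a))"
    proof (rule nn_integral_FTC_atLeast)
      show "((\<lambda>t. - exp (- a * t) / a) \<longlongrightarrow> 0) at_top"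
        using assms by real_asymp
      show "((\<lambda>t. - exp (- a * t) / a) has_real_derivative exp (- a * t)) (at t)" for t
        using assms by (auto intro!: derivative_eq_intros)
    qed auto
    then show ?thesis by simp
  qed
  \<comment> \<open>The two half-line pieces overlap at t = 0, so the pointwise comparison is only
    an inequality.\<close>
  have "(\<integral>\<^sup>+t. ennreal (exp (- a * \<bar>t\<bar>)) \<partial>lborel) \<le> (\<integral>\<^sup>+t. ?h t + ?h (- t) \<partial>lborel)"
    by (intro nn_integral_mono) (auto simp: indicator_def abs_if)
  also have "\<dots> = (\<integral>\<^sup>+t. ?h t \<partial>lborel) + (\<integral>\<^sup>+t. ?h (- t) \<partial>lborel)"
    by (intro nn_integral_add) auto
  also have "(\<integral>\<^sup>+t. ?h (- t) \<partial>lborel) = (\<integral>\<^sup>+t. ?h t \<partial>lborel)"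
    by (subst nn_integral_real_affine[of ?h "-1" 0]) auto
  finally show ?thesis
    using assms unfolding h by (simp flip: ennreal_plus)
qed

text \<open>On the cross-polytope \<open>exp (d - d * l1-norm) \<ge> 1\<close>, and this function integrates to
  \<open>(2 e / d) ^ d\<close>, as it factorises over the coordinates.\<close>

lemma vol_cross_polytope_le:
  assumes "d \<ge> 1"
  shows "vol d (cross_polytope d) \<le> (2 * exp 1 / d) ^ d"
proof -
  interpret product_sigma_finite "\<lambda>_::nat. lborel :: real measure" ..
  let ?M = "\<Pi>\<^sub>M i\<in>{..<d}. lborel :: real measure"
  let ?R = "(\<lambda>x. restrict x {..<d}) ` cross_polytope d"
  \<comment> \<open>The rate d is the value of a minimising exp(a) (2/a)^d, the bound that exp(a - a
    * l1-norm) yields; the constant exp(d) is shared out as one factor e per coordinate.\<close>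
  let ?g = "\<lambda>t::real. ennreal (exp 1 * exp (- real d * \<bar>t\<bar>))"
  have R: "?R \<in> sets ?M"
    by (rule restrict_image_in_sets_PiM[OF compact_cross_polytope]) (auto simp: cross_polytope_def)
  have "emeasure ?M ?R = (\<integral>\<^sup>+x. indicator ?R x \<partial>?M)"
    using R by simp
  also have "\<dots> \<le> (\<integral>\<^sup>+x. (\<Prod>i<d. ?g (x i)) \<partial>?M)"
  proof (rule nn_integral_mono)
    fix x
    show "indicator ?R x \<le> (\<Prod>i<d. ?g (x i))"
    proof (cases "x \<in> ?R")
      case True
      then have le: "(\<Sum>i<d. \<bar>x i\<bar>) \<le> 1" by (auto simp: cross_polytope_def)
      have "(\<Prod>i<d. exp 1 * exp (- real d * \<bar>x i\<bar>)) = exp (\<Sum>i<d. 1 - d * \<bar>x i\<bar>)"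
        by (simp add: exp_sum flip: exp_add)
      also have "(\<Sum>i<d. 1 - d * \<bar>x i\<bar>) = d * (1 - (\<Sum>i<d. \<bar>x i\<bar>))"
        by (simp add: sum_subtractf sum_distrib_left algebra_simps)
      finally have "(\<Prod>i<d. exp 1 * exp (- real d * \<bar>x i\<bar>)) \<ge> 1"
        using le by simp
      then show ?thesis using True by (simp add: prod_ennreal)
    qed simp
  qed
  also have "\<dots> = (\<Prod>i<d. \<integral>\<^sup>+t. ?g t \<partial>lborel)"
    by (rule product_nn_integral_prod) auto
  also have "\<dots> \<le> (\<Prod>i<d. ennreal (2 * exp 1 / d))"
  proof (rule prod_mono_ennreal)
    have "(\<integral>\<^sup>+t. ?g t \<partial>lborel) = ennreal (exp 1) * (\<integral>\<^sup>+t. ennreal (exp (- real d * \<bar>t\<bar>)) \<partial>lborel)"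
      by (simp add: ennreal_mult nn_integral_cmult)
    also have "\<dots> \<le> ennreal (exp 1) * ennreal (2 / d)"
      using assms by (intro mult_left_mono nn_integral_exp_abs) auto
    also have "\<dots> = ennreal (2 * exp 1 / d)"
      by (simp add: mult.commute flip: ennreal_mult)
    finally show "(\<integral>\<^sup>+t. ?g t \<partial>lborel) \<le> ennreal (2 * exp 1 / d)" .
  qed
  also have "\<dots> = ennreal ((2 * exp 1 / d) ^ d)"
    by (simp add: ennreal_power)
  finally show ?thesis
    unfolding vol_def measure_def by (intro enn2real_leI) auto
qed

lemma cross_polytope_slicing_lower:
  assumes "d \<ge> 1"
  shows "1 / (2 * exp 1) * real d
      * real (MAX i\<in>{..<d}. lattice_card d (cross_polytope d \<inter> orth_compl d (std_basis i)))
      * vol d (cross_polytope d) powr (1 / real d) \<le> real (lattice_card d (cross_polytope d))"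
proof -
  let ?P = "cross_polytope d"
  let ?M = "MAX i\<in>{..<d}. lattice_card d (?P \<inter> orth_compl d (std_basis i))"
  have "lattice_card d (?P \<inter> orth_compl d (std_basis i)) \<le> lattice_card d ?P" for i
    unfolding lattice_card_def
    by (intro card_mono finite_lattice_points compact_cross_polytope) auto
  \<comment> \<open>The maximum is over a nonempty index set because d >= 1.\<close>
  then have M: "?M \<le> lattice_card d ?P"
    using assms by (subst Max_le_iff) (auto simp: lessThan_empty_iff)
  have "vol d ?P powr (1 / d) \<le> ((2 * exp 1 / d) ^ d) powr (1 / d)"
    by (intro powr_mono2 vol_cross_polytope_le assms) (auto simp: vol_def)
  also have "\<dots> = 2 * exp 1 / d"
    using assms by (simp add: powr_realpow[symmetric] powr_powr)
  finally have "1 / (2 * exp 1) * real d * real ?M * vol d ?P powr (1 / d)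
      \<le> 1 / (2 * exp 1) * real d * real ?M * (2 * exp 1 / d)"
    by (intro mult_left_mono) auto
  also have "\<dots> = real ?M" using assms by (simp add: field_simps)
  also have "\<dots> \<le> real (lattice_card d ?P)" using M by simp
  finally show ?thesis .
qed


theorem theorem6:
  shows "(\<exists>C::real. C > 0 \<and>
            (\<forall>d\<ge>1. \<forall>K. convex_body d K \<and> unconditional K \<and>
                affine_hull_dim (K \<inter> int_lattice d) = d \<longrightarrow>
              real (lattice_card d K)
                \<le> C * real d
                  * real (MAX i\<in>{..<d}. lattice_card d (K \<inter> orth_compl d (std_basis i)))
                  * vol d K powr (1 / real d)))
       \<and> (\<exists>c::real. c > 0 \<and>
            (\<forall>d\<ge>1. \<exists>K. convex_body d K \<and> unconditional K \<and>
                affine_hull_dim (K \<inter> int_lattice d) = d \<and>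
              real (lattice_card d K)
                \<ge> c * real d
                  * real (MAX i\<in>{..<d}. lattice_card d (K \<inter> orth_compl d (std_basis i)))
                  * vol d K powr (1 / real d)))"
proof (rule conjI, goal_cases)
  case 1
  show ?case
  proof (intro exI[of _ "3 / 2 :: real"] conjI allI impI)
    fix d :: nat and K
    assume "d \<ge> 1" "convex_body d K \<and> unconditional K \<and> affine_hull_dim (K \<inter> int_lattice d) = d"
    then show "real (lattice_card d K)
        \<le> 3 / 2 * real d * real (MAX i\<in>{..<d}. lattice_card d (K \<inter> orth_compl d (std_basis i)))
          * vol d K powr (1 / real d)"
      using unconditional_slicing_upper by blast
  qed simp
next
  case 2
  show ?case
  proof (intro exI[of _ "1 / (2 * exp 1) :: real"] conjI allI impI)
    fix d :: nat assume "d \<ge> 1"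
    then show "\<exists>K. convex_body d K \<and> unconditional K \<and> affine_hull_dim (K \<inter> int_lattice d) = d \<and>
        real (lattice_card d K)
          \<ge> 1 / (2 * exp 1) * real d
            * real (MAX i\<in>{..<d}. lattice_card d (K \<inter> orth_compl d (std_basis i)))
            * vol d K powr (1 / real d)"
      using convex_body_cross_polytope unconditional_cross_polytope affine_hull_dim_cross_polytope
        cross_polytope_slicing_lower by blast
  qed simp
qed

end
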